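(* Let $\mathfrak A$ be a generalized model in the narrow sense with universe $\beta X$. Then $\lim i(\mathfrak A)=e(\mathfrak A)$; that is, for each functional symbol $F$ and predicate symbol $R$, the ultrafilters $i(\imath(F))$ and $i(\imath(R))$ have limits $e(\imath(F))$ and $e(\imath(R))$, respectively, where $\imath$ is the interpretation of $\mathfrak A$.
   Context: $\beta X$ is the set of ultrafilters on $X$, $X\subseteq\beta X$ via principal ultrafilters, standard compact Hausdorff topology; $(\forall^{\mathfrak u}x)\varphi$ means $\{x:\varphi\}\in\mathfrak u$. For $f:X^n\to X$, $\tilde f(\mathfrak u_1,\dots,\mathfrak u_n)=\{A:(\forall^{\mathfrak u_1}x_1)\cdots(\forall^{\mathfrak u_n}x_n)f(x_1,\dots,x_n)\in A\}$; for $Q\subseteq X^n$, $\tilde Q=\{(\mathfrak u_i):(\forall^{\mathfrak u_1}x_1)\cdots(\forall^{\mathfrak u_n}x_n)(x_1,\dots,x_n)\in Q\}$. A generalized model in the narrow sense with universe $\beta X$ is an interpretation $\imath$ with $\imath(F)\in\beta(X^{X^n})$, $\imath(R)\in\beta\,\mathcal P(X^n)$. $\mathrm{RC}_n$: maps $(\beta X)^n\to\beta X$ right continuous w.r.t. $X$ (continuous in the $i$-th argument whenever the first $i-1$ arguments lie in $X$), with the topology of pointwise convergence on $X^n$ (compact Hausdorff); $\mathrm{RClop}_n$: subsets of $(\beta X)^n$ right clopen w.r.t. $X$ (all such sections clopen), with the topology of pointwise convergence on $X^n$ of characteristic functions into discrete $\{0,1\}$. $e:\beta(X^{X^n})\to\mathrm{RC}_n$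 is the unique continuous extension of $f\mapsto\tilde f$, and $e:\beta\,\mathcal P(X^n)\to\mathrm{RClop}_n$ the unique continuous extension of $Q\mapsto\tilde Q$; $e(\mathfrak A)=(\beta X,e(\imath(F)),\dots,e(\imath(R)),\dots)$. $i(\mathfrak f)=\{B:\{f:\tilde f\in B\}\in\mathfrak f\}$ (an ultrafilter on $(\beta X)^{(\beta X)^n}$ concentrated on $\mathrm{RC}_n$), $i(\mathfrak r)=\{B:\{Q:\tilde Q\in B\}\in\mathfrak r\}$ (an ultrafilter on $\mathcal P((\beta X)^n)$ concentrated on $\mathrm{RClop}_n$); $i(\mathfrak A)$ is the generalized model in the wide sense with universe $\beta X$ interpreting each symbol by $i$ of its $\imath$-interpretation. Limits of these ultrafilters are taken in $\mathrm{RC}_n$, resp. $\mathrm{RClop}_n$ (a limit is the unique point of convergence), and $\lim i(\mathfrak A)$ is the ordinary model on $\beta X$ interpreting each symbol by the limit. *)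

theory Defs
  imports "HOL-Analysis.Analysis" "HOL-Library.NList"
begin

text \<open>
  Sets are carriers inside types: \<open>X :: 'a set\<close>, the tuples \<open>X\<^sup>n\<close> are the lists in \<open>nlists n X\<close>,
  and a map defined on a set is extensional, i.e. \<open>undefined\<close> outside of that set.
\<close>

definition ultrafilter_on :: "'a set \<Rightarrow> 'a set set \<Rightarrow> bool" where
  "ultrafilter_on S U \<longleftrightarrow>
     U \<subseteq> Pow S \<and> S \<in> U \<and> {} \<notin> U \<and>
     (\<forall>A\<in>U. \<forall>B\<in>U. A \<inter> B \<in> U) \<and>
     (\<forall>A\<in>U. \<forall>B. A \<subseteq> B \<and> B \<subseteq> S \<longrightarrow> B \<in> U) \<and>
     (\<forall>A. A \<subseteq> S \<longrightarrow> A \<in> U \<or> S - A \<in> U)"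

definition beta :: "'a set \<Rightarrow> 'a set set set" where
  "beta S = {U. ultrafilter_on S U}"

definition principal :: "'a set \<Rightarrow> 'a \<Rightarrow> 'a set set" where
  "principal S x = {A. A \<subseteq> S \<and> x \<in> A}"

definition beta_top :: "'a set \<Rightarrow> 'a set set topology" where
  "beta_top S = topology_generated_by {{U \<in> beta S. A \<in> U} |A. A \<subseteq> S}"

text \<open>
  \<open>all_ultra X [\<uu>\<^sub>1, \<dots>, \<uu>\<^sub>n] \<phi>\<close> is
  \<open>(\<forall>\<^sup>\<uu>\<^sup>1 x\<^sub>1) \<dots> (\<forall>\<^sup>\<uu>\<^sup>n x\<^sub>n) \<phi> [x\<^sub>1, \<dots>, x\<^sub>n]\<close>.
\<close>

primrec all_ultra :: "'a set \<Rightarrow> 'a set set list \<Rightarrow> ('a list \<Rightarrow> bool) \<Rightarrow> bool" where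
  "all_ultra X [] \<phi> \<longleftrightarrow> \<phi> []"
| "all_ultra X (u # us) \<phi> \<longleftrightarrow> {x \<in> X. all_ultra X us (\<lambda>xs. \<phi> (x # xs))} \<in> u"

definition Ops :: "'a set \<Rightarrow> nat \<Rightarrow> ('a list \<Rightarrow> 'a) set" where
  "Ops X n = (nlists n X \<rightarrow>\<^sub>E X)"

definition Rels :: "'a set \<Rightarrow> nat \<Rightarrow> 'a list set set" where
  "Rels X n = Pow (nlists n X)"

definition op_ext :: "'a set \<Rightarrow> nat \<Rightarrow> ('a list \<Rightarrow> 'a) \<Rightarrow> 'a set set list \<Rightarrow> 'a set set" where
  "op_ext X n f = (\<lambda>us \<in> nlists n (beta X). {A. A \<subseteq> X \<and> all_ultra X us (\<lambda>xs. f xs \<in> A)})"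

definition rel_ext :: "'a set \<Rightarrow> nat \<Rightarrow> 'a list set \<Rightarrow> 'a set set list set" where
  "rel_ext X n Q = {us \<in> nlists n (beta X). all_ultra X us (\<lambda>xs. xs \<in> Q)}"

text \<open>
  In the tuple \<open>map (principal X) xs @ u # vs\<close>, the arguments before \<open>u\<close> lie in \<open>X\<close> (seen inside
  \<open>beta X\<close>), and those after \<open>u\<close> are arbitrary.
\<close>

definition RC :: "'a set \<Rightarrow> nat \<Rightarrow> ('a set set list \<Rightarrow> 'a set set) set" where
  "RC X n = {g \<in> Ops (beta X) n.
     \<forall>xs \<in> lists X. \<forall>vs \<in> lists (beta X). length xs + 1 + length vs = n \<longrightarrow>
       continuous_map (beta_top X) (beta_top X) (\<lambda>u. g (map (principal X) xs @ u # vs))}"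

definition RClop :: "'a set \<Rightarrow> nat \<Rightarrow> 'a set set list set set" where
  "RClop X n = {Q \<in> Rels (beta X) n.
     \<forall>xs \<in> lists X. \<forall>vs \<in> lists (beta X). length xs + 1 + length vs = n \<longrightarrow>
       (let s = {u \<in> beta X. map (principal X) xs @ u # vs \<in> Q}
        in openin (beta_top X) s \<and> closedin (beta_top X) s)}"

definition RC_top :: "'a set \<Rightarrow> nat \<Rightarrow> ('a set set list \<Rightarrow> 'a set set) topology" where
  "RC_top X n =
     pullback_topology (RC X n)
       (\<lambda>g. \<lambda>xs \<in> nlists n X. g (map (principal X) xs))
       (product_topology (\<lambda>_. beta_top X) (nlists n X))"

definition RClop_top :: "'a set \<Rightarrow> nat \<Rightarrow> 'a set set list set topology" where
  "RClop_top X n =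
     pullback_topology (RClop X n)
       (\<lambda>Q. \<lambda>xs \<in> nlists n X. indicator Q (map (principal X) xs))
       (product_topology (\<lambda>_. discrete_topology {0, 1::nat}) (nlists n X))"

definition e_op :: "'a set \<Rightarrow> nat \<Rightarrow> ('a list \<Rightarrow> 'a) set set \<Rightarrow> 'a set set list \<Rightarrow> 'a set set" where
  "e_op X n = (THE h. h \<in> extensional (beta (Ops X n)) \<and>
     continuous_map (beta_top (Ops X n)) (RC_top X n) h \<and>
     (\<forall>f \<in> Ops X n. h (principal (Ops X n) f) = op_ext X n f))"

definition e_rel :: "'a set \<Rightarrow> nat \<Rightarrow> 'a list set set set \<Rightarrow> 'a set set list set" where
  "e_rel X n = (THE h. h \<in> extensional (beta (Rels X n)) \<and>
     continuous_map (beta_top (Rels X n)) (RClop_top X n) h \<and>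
     (\<forall>Q \<in> Rels X n. h (principal (Rels X n) Q) = rel_ext X n Q))"

definition i_op ::
  "'a set \<Rightarrow> nat \<Rightarrow> ('a list \<Rightarrow> 'a) set set \<Rightarrow> ('a set set list \<Rightarrow> 'a set set) set set" where
  "i_op X n \<ff> = {B. B \<subseteq> Ops (beta X) n \<and> {f \<in> Ops X n. op_ext X n f \<in> B} \<in> \<ff>}"

definition i_rel ::
  "'a set \<Rightarrow> nat \<Rightarrow> 'a list set set set \<Rightarrow> 'a set set list set set set" where
  "i_rel X n \<rr> = {B. B \<subseteq> Rels (beta X) n \<and> {Q \<in> Rels X n. rel_ext X n Q \<in> B} \<in> \<rr>}"

text \<open>
  \<open>D\<close> may be an ultrafilter on a superset of \<open>topspace T\<close>. As \<open>topspace T\<close> is itself open,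
  \<open>D\<close> can only converge in \<open>T\<close> if it is concentrated on \<open>topspace T\<close>.
\<close>

definition ultra_converges :: "'a topology \<Rightarrow> 'a set set \<Rightarrow> 'a \<Rightarrow> bool" where
  "ultra_converges T D p \<longleftrightarrow> p \<in> topspace T \<and> (\<forall>V. openin T V \<and> p \<in> V \<longrightarrow> V \<in> D)"

definition is_ultra_limit :: "'a topology \<Rightarrow> 'a set set \<Rightarrow> 'a \<Rightarrow> bool" where
  "is_ultra_limit T D p \<longleftrightarrow> ultra_converges T D p \<and> (\<forall>q. ultra_converges T D q \<longrightarrow> q = p)"

definition ultra_lim :: "'a topology \<Rightarrow> 'a set set \<Rightarrow> 'a" where
  "ultra_lim T D = (THE p. is_ultra_limit T D p)"

record ('f, 'r) signature =
  fsyms :: "'f set"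
  psyms :: "'r set"
  far :: "'f \<Rightarrow> nat"
  par :: "'r \<Rightarrow> nat"

text \<open>
  The same record serves for ordinary models and for generalized models in both senses; they differ
  in the types \<open>'fi\<close>, \<open>'ri\<close> of the objects interpreting the symbols.
\<close>

record ('u, 'f, 'fi, 'r, 'ri) model =
  univ :: "'u set"
  op_interp :: "'f \<Rightarrow> 'fi"
  rel_interp :: "'r \<Rightarrow> 'ri"

definition narrow_model :: "('f, 'r) signature \<Rightarrow> 'a set \<Rightarrow>
    ('a set set, 'f, ('a list \<Rightarrow> 'a) set set, 'r, 'a list set set set) model \<Rightarrow> bool" where
  "narrow_model L X \<AA> \<longleftrightarrow>
     univ \<AA> = beta X \<and>
     op_interp \<AA> \<in> (\<Pi>\<^sub>E F \<in> fsyms L. beta (Ops X (far L F))) \<and>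
     rel_interp \<AA> \<in> (\<Pi>\<^sub>E R \<in> psyms L. beta (Rels X (par L R)))"

definition e_model :: "('f, 'r) signature \<Rightarrow> 'a set \<Rightarrow>
    ('a set set, 'f, ('a list \<Rightarrow> 'a) set set, 'r, 'a list set set set) model \<Rightarrow>
    ('a set set, 'f, 'a set set list \<Rightarrow> 'a set set, 'r, 'a set set list set) model" where
  "e_model L X \<AA> =
     \<lparr>univ = beta X,
      op_interp = (\<lambda>F \<in> fsyms L. e_op X (far L F) (op_interp \<AA> F)),
      rel_interp = (\<lambda>R \<in> psyms L. e_rel X (par L R) (rel_interp \<AA> R))\<rparr>"

definition i_model :: "('f, 'r) signature \<Rightarrow> 'a set \<Rightarrow>
    ('a set set, 'f, ('a list \<Rightarrow> 'a) set set, 'r, 'a list set set set) model \<Rightarrow>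
    ('a set set, 'f, ('a set set list \<Rightarrow> 'a set set) set set,
      'r, 'a set set list set set set) model" where
  "i_model L X \<AA> =
     \<lparr>univ = beta X,
      op_interp = (\<lambda>F \<in> fsyms L. i_op X (far L F) (op_interp \<AA> F)),
      rel_interp = (\<lambda>R \<in> psyms L. i_rel X (par L R) (rel_interp \<AA> R))\<rparr>"

definition lim_model :: "('f, 'r) signature \<Rightarrow> 'a set \<Rightarrow>
    ('a set set, 'f, ('a set set list \<Rightarrow> 'a set set) set set,
      'r, 'a set set list set set set) model \<Rightarrow>
    ('a set set, 'f, 'a set set list \<Rightarrow> 'a set set, 'r, 'a set set list set) model" where
  "lim_model L X \<BB> =
     \<lparr>univ = beta X,
      op_interp = (\<lambda>F \<in> fsyms L. ultra_lim (RC_top X (far L F)) (op_interp \<BB> F)),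
      rel_interp = (\<lambda>R \<in> psyms L. ultra_lim (RClop_top X (par L R)) (rel_interp \<BB> R))\<rparr>"

end

theory Submission
  imports Defs
begin

text \<open>
  The value of the extension \<open>e\<close> at an ultrafilter \<open>\<ff>\<close> of operations can be written down: \<open>A\<close> belongs
  to \<open>e \<ff> (\<uu>\<^sub>1, \<dots>, \<uu>\<^sub>n)\<close> iff for \<open>\<uu>\<^sub>1\<close>-almost all \<open>x\<^sub>1\<close>, ..., for \<open>\<uu>\<^sub>n\<close>-almost all \<open>x\<^sub>n\<close>, for
  \<open>\<ff>\<close>-almost all \<open>f\<close>, \<open>f (x\<^sub>1, \<dots>, x\<^sub>n) \<in> A\<close>; similarly for relations. Uniqueness of \<open>e\<close> holds since principal
  ultrafilters are dense and the target is Hausdorff: a right continuous map is determined by its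
  values on principal tuples. Finally, if \<open>V\<close> is an open neighbourhood of \<open>e \<ff>\<close>, continuity of \<open>e\<close> gives
  \<open>A \<in> \<ff>\<close> such that \<open>e\<close> maps all ultrafilters containing \<open>A\<close>, in particular the principal ones, into \<open>V\<close>,
  and this says that \<open>V \<in> i \<ff>\<close>.
\<close>

declare nlistsE_length [simp del] nlistsE_set [simp del]
  \<comment> \<open>\<open>nlists_iff_lists\<close> below makes these conditional rewrite rules loop\<close>

section \<open>Ultrafilters and the space of ultrafilters\<close>

lemma betaD:
  assumes "U \<in> beta S"
  shows beta_subset: "A \<in> U \<Longrightarrow> A \<subseteq> S"
    and beta_empty: "{} \<notin> U"
    and beta_space: "S \<in> U"
    and beta_Int: "A \<in> U \<Longrightarrow> B \<in> U \<Longrightarrow> A \<inter> B \<in> U"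
    and beta_mono: "A \<in> U \<Longrightarrow> A \<subseteq> B \<Longrightarrow> B \<subseteq> S \<Longrightarrow> B \<in> U"
    and beta_cases: "A \<subseteq> S \<Longrightarrow> A \<notin> U \<Longrightarrow> S - A \<in> U"
  using assms unfolding beta_def ultrafilter_on_def by blast+

lemma beta_Diff_iff:
  assumes "U \<in> beta S" "A \<subseteq> S"
  shows "S - A \<in> U \<longleftrightarrow> A \<notin> U"
  using beta_Int[OF assms(1), of A "S - A"] beta_empty[OF assms(1)] beta_cases[OF assms] by auto

lemma beta_Collect_not_iff:
  assumes "U \<in> beta S"
  shows "{x \<in> S. \<not> P x} \<in> U \<longleftrightarrow> {x \<in> S. P x} \<notin> U"
proof -
  have "{x \<in> S. \<not> P x} = S - {x \<in> S. P x}" by auto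
  then show ?thesis using beta_Diff_iff[OF assms, of "{x \<in> S. P x}"] by auto
qed

lemma beta_Collect_conj_iff:
  assumes "U \<in> beta S"
  shows "{x \<in> S. P x \<and> Q x} \<in> U \<longleftrightarrow> {x \<in> S. P x} \<in> U \<and> {x \<in> S. Q x} \<in> U"
proof -
  have "{x \<in> S. P x \<and> Q x} = {x \<in> S. P x} \<inter> {x \<in> S. Q x}" by auto
  then show ?thesis
    using beta_Int[OF assms, of "{x \<in> S. P x}" "{x \<in> S. Q x}"]
      beta_mono[OF assms, of "{x \<in> S. P x \<and> Q x}" "{x \<in> S. P x}"]
      beta_mono[OF assms, of "{x \<in> S. P x \<and> Q x}" "{x \<in> S. Q x}"] by auto
qed

text \<open>The maximality condition is stated as an equivalence, so that properness comes with it: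
  for \<open>A = {}\<close> it excludes \<open>{}\<close> because \<open>S\<close> is a
  member.\<close>

lemma betaI:
  assumes "\<And>A. A \<in> U \<Longrightarrow> A \<subseteq> S"
    and "S \<in> U"
    and "\<And>A B. A \<in> U \<Longrightarrow> B \<in> U \<Longrightarrow> A \<inter> B \<in> U"
    and "\<And>A B. A \<in> U \<Longrightarrow> A \<subseteq> B \<Longrightarrow> B \<subseteq> S \<Longrightarrow> B \<in> U"
    and "\<And>A. A \<subseteq> S \<Longrightarrow> S - A \<in> U \<longleftrightarrow> A \<notin> U"
  shows "U \<in> beta S"
proof -
  have "{} \<notin> U" using assms(2) assms(5)[of "{}"] by simp
  moreover have "A \<in> U \<or> S - A \<in> U" if "A \<subseteq> S" for A using assms(5)[OF that] by blast
  ultimately show ?thesis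
    unfolding beta_def ultrafilter_on_def mem_Collect_eq
    using assms(1-4) by (meson PowI subsetI)
qed

lemma principal_in_beta: "x \<in> S \<Longrightarrow> principal S x \<in> beta S"
  by (rule betaI) (auto simp: principal_def)

lemma Collect_in_principal_iff: "x \<in> S \<Longrightarrow> {y \<in> S. P y} \<in> principal S x \<longleftrightarrow> P x"
  by (auto simp: principal_def)

lemma topspace_beta_top [simp]: "topspace (beta_top S) = beta S"
proof -
  have "beta S \<subseteq> {U \<in> beta S. S \<in> U}" using beta_space by blast
  then show ?thesis unfolding beta_top_def topology_generated_by_topspace by blast
qed

lemma openin_beta_top_basic: "A \<subseteq> S \<Longrightarrow> openin (beta_top S) {U \<in> beta S. A \<in> U}"
  unfolding beta_top_def by (rule topology_generated_by_Basis) auto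

text \<open>The generating sets are a base and not merely a subbase, because the set of ultrafilters
  containing \<open>A \<inter> B\<close> is the intersection of those for \<open>A\<close> and for
  \<open>B\<close>. Induction over the generation of open sets.\<close>

lemma openin_beta_top_neighbourhood:
  assumes "openin (beta_top S) V" "U \<in> V"
  obtains A where "A \<in> U" "{W \<in> beta S. A \<in> W} \<subseteq> V"
proof -
  have "generate_topology_on {{U \<in> beta S. A \<in> U} |A. A \<subseteq> S} V"
    using assms(1) unfolding beta_top_def by (rule openin_topology_generated_by)
  then have "U \<in> V \<Longrightarrow> U \<in> beta S \<Longrightarrow> \<exists>A\<in>U. {W \<in> beta S. A \<in> W} \<subseteq> V"
  proof (induction rule: generate_topology_on.induct)
    case (Int a b)
    then obtain A B where AB: "A \<in> U" "{W \<in> beta S. A \<in> W} \<subseteq> a" "B \<in> U" "{W \<in> beta S. B \<in> W} \<subseteq> b"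
      by auto
    have "{W \<in> beta S. A \<inter> B \<in> W} \<subseteq> a \<inter> b"
      using AB beta_mono[of _ S "A \<inter> B"] beta_subset[OF Int.prems(2)] by blast
    then show ?case using beta_Int[OF Int.prems(2) AB(1,3)] by blast
  next
    case (UN K)
    then show ?case by blast
  next
    case (Basis s)
    then show ?case by blast
  qed simp
  moreover have "U \<in> beta S" using openin_subset[OF assms(1)] assms(2) by auto
  ultimately show ?thesis using assms(2) that by blast
qed

text \<open>A nonempty open set contains a basic set given by some member \<open>A\<close> of an
  ultrafilter. Such an \<open>A\<close> is nonempty, and each of its points yields a principal
  ultrafilter in the basic set.\<close>

lemma principal_dense: "beta_top S closure_of (principal S ` S) = beta S"
proof -
  have "principal S ` S \<inter> V \<noteq> {}" if V: "openin (beta_top S) V" "V \<noteq> {}" for V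
  proof -
    obtain U where U: "U \<in> V" "U \<in> beta S" using V openin_subset[OF V(1)] by auto
    obtain A where A: "A \<in> U" "{W \<in> beta S. A \<in> W} \<subseteq> V"
      using openin_beta_top_neighbourhood[OF V(1) U(1)] by blast
    obtain x where x: "x \<in> A" using beta_empty[OF U(2)] A(1) by (cases "A = {}") auto
    have "A \<subseteq> S" using beta_subset[OF U(2) A(1)] .
    then have "x \<in> S" "A \<in> principal S x" using x by (auto simp: principal_def)
    then have "principal S x \<in> {W \<in> beta S. A \<in> W}" "x \<in> S" using principal_in_beta by auto
    then show ?thesis using A(2) by blast
  qed
  then show ?thesis using dense_intersects_open[of "beta_top S" "principal S ` S"] by simp
qed

text \<open>The set where two continuous maps into a Hausdorff space agree is closed; here it
  contains a dense set.\<close>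

lemma continuous_map_beta_dense_eq:
  assumes "Hausdorff_space T" "continuous_map (beta_top S) T g" "continuous_map (beta_top S) T h"
    and "\<And>x. x \<in> S \<Longrightarrow> g (principal S x) = h (principal S x)" "U \<in> beta S"
  shows "g U = h U"
  by (rule forall_in_closure_of_eq[where S = "principal S ` S", OF _ assms(1-3)])
     (use assms(4,5) principal_dense in auto)

lemma Hausdorff_beta_top: "Hausdorff_space (beta_top S)"
  unfolding Hausdorff_space_def
proof (intro allI impI)
  fix U V assume UV: "U \<in> topspace (beta_top S) \<and> V \<in> topspace (beta_top S) \<and> U \<noteq> V"
  \<comment> \<open>Distinctness only gives a set that lies in exactly one of the two ultrafilters;
    if that one is \<open>V\<close>, the complement is taken.\<close>
  have *: "\<exists>A\<subseteq>S. A \<in> U \<and> A \<notin> V"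
    using UV beta_mono beta_subset beta_Diff_iff[of U S] beta_Diff_iff[of V S]
    by (metis Diff_subset subsetI subset_antisym topspace_beta_top)
  then obtain A where A: "A \<subseteq> S" "A \<in> U" "A \<notin> V" by blast
  let ?O = "\<lambda>A. {W \<in> beta S. A \<in> W}"
  have "openin (beta_top S) (?O A)" "openin (beta_top S) (?O (S - A))"
    using A(1) by (auto intro!: openin_beta_top_basic)
  moreover have "disjnt (?O A) (?O (S - A))"
    using A(1) beta_Diff_iff by (auto simp: disjnt_def)
  moreover have "U \<in> ?O A" "V \<in> ?O (S - A)" using UV A beta_Diff_iff by auto
  ultimately show "\<exists>O1 O2. openin (beta_top S) O1 \<and> openin (beta_top S) O2 \<and> U \<in> O1 \<and> V \<in> O2 \<and> disjnt O1 O2"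
    by blast
qed

lemma continuous_map_into_beta_top:
  assumes "\<And>y. y \<in> topspace Y \<Longrightarrow> h y \<in> beta S"
    and "\<And>A. A \<subseteq> S \<Longrightarrow> openin Y {y \<in> topspace Y. A \<in> h y}"
  shows "continuous_map Y (beta_top S) h"
  unfolding beta_top_def
proof (rule continuous_on_generated_topo)
  fix V assume "V \<in> {{U \<in> beta S. A \<in> U} |A. A \<subseteq> S}"
  then obtain A where A: "A \<subseteq> S" "V = {U \<in> beta S. A \<in> U}" by blast
  have "h -` V \<inter> topspace Y = {y \<in> topspace Y. A \<in> h y}" using assms(1) A(2) by auto
  then show "openin Y (h -` V \<inter> topspace Y)" using assms(2)[OF A(1)] by simp
next
  \<comment> \<open>The generating sets must also cover the image; the one given by \<open>S\<close>
    itself does.\<close>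
  have "h y \<in> {U \<in> beta S. S \<in> U}" if "y \<in> topspace Y" for y
    using assms(1)[OF that] beta_space by simp
  then show "h ` topspace Y \<subseteq> \<Union> {{U \<in> beta S. A \<in> U} |A. A \<subseteq> S}" by blast
qed

lemma clopen_beta_basic:
  assumes "A \<subseteq> S"
  shows "openin (beta_top S) {U \<in> beta S. A \<in> U} \<and> closedin (beta_top S) {U \<in> beta S. A \<in> U}"
proof -
  have "beta S - {U \<in> beta S. A \<in> U} = {U \<in> beta S. S - A \<in> U}"
    using beta_Diff_iff[OF _ assms] by auto
  then show ?thesis using assms openin_beta_top_basic[of _ S] by (auto simp: closedin_def)
qed

text \<open>If \<open>U\<close> lies in an open set, then \<open>U\<close>-almost all principal
  ultrafilters do too, by a basic neighbourhood. Applied to \<open>C\<close> and to its complement,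
  this gives both directions. A clopen set is thus known from its principal elements.\<close>

lemma clopen_beta_iff_principal:
  assumes "openin (beta_top S) C" "closedin (beta_top S) C" "U \<in> beta S"
  shows "U \<in> C \<longleftrightarrow> {x \<in> S. principal S x \<in> C} \<in> U"
proof -
  have *: "{x \<in> S. principal S x \<in> V} \<in> U" if V: "openin (beta_top S) V" "U \<in> V" for V
  proof -
    obtain A where A: "A \<in> U" "{W \<in> beta S. A \<in> W} \<subseteq> V"
      using openin_beta_top_neighbourhood[OF V] by blast
    have "A \<subseteq> S" using beta_subset[OF assms(3) A(1)] .
    have "A \<subseteq> {x \<in> S. principal S x \<in> V}"
    proof
      fix x assume "x \<in> A"
      then have "x \<in> S" "A \<in> principal S x" using \<open>A \<subseteq> S\<close> by (auto simp: principal_def)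
      then show "x \<in> {x \<in> S. principal S x \<in> V}" using A(2) principal_in_beta[of x S] by blast
    qed
    then show ?thesis using beta_mono[OF assms(3) A(1)] by auto
  qed
  have "openin (beta_top S) (beta S - C)" using assms(2) by (simp add: closedin_def)
  moreover have "{x \<in> S. principal S x \<in> beta S - C} = {x \<in> S. \<not> principal S x \<in> C}"
    using principal_in_beta by auto
  ultimately show ?thesis
    using *[OF assms(1)] *[of "beta S - C"] assms(3) beta_Collect_not_iff[OF assms(3)] by auto
qed

section \<open>Limits of image ultrafilters\<close>

text \<open>The common core of the two cases: \<open>\<phi>\<close> will be
  \<open>op_ext X n\<close> or \<open>rel_ext X n\<close>, and \<open>h\<close> an explicit
  continuous extension of it. Density and separation identify the described map with
  \<open>h\<close>, continuity gives convergence, and separation makes the limit unique.\<close>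

lemma ultra_limit_unique_extension:
  assumes T: "Hausdorff_space T" "topspace T \<subseteq> Z"
    and h: "continuous_map (beta_top S) T h" "\<And>s. s \<in> S \<Longrightarrow> h (principal S s) = \<phi> s"
    and D: "D \<in> beta S"
  shows "is_ultra_limit T {B. B \<subseteq> Z \<and> {s \<in> S. \<phi> s \<in> B} \<in> D}
    ((THE h. h \<in> extensional (beta S) \<and> continuous_map (beta_top S) T h \<and>
        (\<forall>s \<in> S. h (principal S s) = \<phi> s)) D)" (is "is_ultra_limit T ?E ((THE h. ?P h) D)")
proof -
  \<comment> \<open>The description asks for an extensional map, hence the restriction of
    \<open>h\<close>.\<close>
  have "(THE h. ?P h) = restrict h (beta S)"
  proof (rule the_equality)
    show "?P (restrict h (beta S))"
      using h(2) by (auto simp: principal_in_beta intro: continuous_map_eq[OF h(1)])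
    show "k = restrict h (beta S)" if k: "?P k" for k
    proof (rule extensionalityI)
      show "k U = restrict h (beta S) U" if "U \<in> beta S" for U
      proof -
        have "k U = h U"
          by (rule continuous_map_beta_dense_eq[OF T(1) _ h(1) _ that]) (use k h(2) in simp_all)
        then show ?thesis using that by simp
      qed
    qed (use k in simp_all)
  qed
  then have e: "(THE h. ?P h) D = h D" using D by simp
  have conv: "ultra_converges T ?E (h D)"
    unfolding ultra_converges_def
  proof (intro conjI allI impI)
    show "h D \<in> topspace T" using h(1) D continuous_map_image_subset_topspace by fastforce
  next
    fix V assume V: "openin T V \<and> h D \<in> V"
    have "openin (beta_top S) {U \<in> beta S. h U \<in> V}"
      using openin_continuous_map_preimage[OF h(1)] V by auto
    then obtain A where A: "A \<in> D" "{W \<in> beta S. A \<in> W} \<subseteq> {U \<in> beta S. h U \<in> V}"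
      using openin_beta_top_neighbourhood[of S _ D] V D by blast
    have AS: "A \<subseteq> S" using beta_subset[OF D A(1)] .
    have "A \<subseteq> {s \<in> S. \<phi> s \<in> V}"
    proof
      fix s assume s: "s \<in> A"
      then have sS: "s \<in> S" and "A \<in> principal S s" using AS by (auto simp: principal_def)
      then have "principal S s \<in> {W \<in> beta S. A \<in> W}" using principal_in_beta by auto
      then have "h (principal S s) \<in> V" using A(2) by blast
      then show "s \<in> {s \<in> S. \<phi> s \<in> V}" using h(2)[OF sS] sS by simp
    qed
    then have "{s \<in> S. \<phi> s \<in> V} \<in> D" using beta_mono[OF D A(1)] by auto
    then show "V \<in> ?E" using V openin_subset T(2) by blast
  qed
  moreover have "q = h D" if q: "ultra_converges T ?E q" for q
  proof (rule ccontr)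
    assume "q \<noteq> h D"
    then obtain V W where VW: "openin T V" "openin T W" "q \<in> V" "h D \<in> W" "disjnt V W"
      using T(1) q conv unfolding Hausdorff_space_def ultra_converges_def by metis
    \<comment> \<open>Two limits with disjoint neighbourhoods would put two disjoint preimages into
      \<open>D\<close>.\<close>
    then have "{s \<in> S. \<phi> s \<in> V} \<in> D" "{s \<in> S. \<phi> s \<in> W} \<in> D"
      using q conv unfolding ultra_converges_def by auto
    then have "{s \<in> S. \<phi> s \<in> V \<and> \<phi> s \<in> W} \<in> D" using beta_Collect_conj_iff[OF D] by auto
    moreover have "{s \<in> S. \<phi> s \<in> V \<and> \<phi> s \<in> W} = {}" using VW(5) by (auto simp: disjnt_iff)
    ultimately show False using beta_empty[OF D] by simp
  qed
  ultimately show ?thesis unfolding is_ultra_limit_def e by blast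
qed

lemma ultra_lim_eq: "is_ultra_limit T D p \<Longrightarrow> ultra_lim T D = p"
  unfolding ultra_lim_def by (rule the_equality) (auto simp: is_ultra_limit_def)

section \<open>Iterated ultrafilter quantifiers\<close>

lemma all_ultra_cong:
  assumes "\<And>xs. xs \<in> nlists (length us) X \<Longrightarrow> \<phi> xs \<longleftrightarrow> \<psi> xs"
  shows "all_ultra X us \<phi> \<longleftrightarrow> all_ultra X us \<psi>"
  using assms
proof (induction us arbitrary: \<phi> \<psi>)
  case (Cons u us)
  have "{x \<in> X. all_ultra X us (\<lambda>xs. \<phi> (x # xs))} = {x \<in> X. all_ultra X us (\<lambda>xs. \<psi> (x # xs))}"
    by (intro Collect_cong conj_cong refl Cons.IH) (simp add: Cons.prems)
  then show ?case by simp
qed simp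

text \<open>Each single ultrafilter quantifier is self-dual, so negation passes through the whole
  prefix without changing it. Here and for conjunction, \<open>\<phi>\<close> stays arbitrary in the
  induction because each quantifier fixes one coordinate.\<close>

lemma all_ultra_not_iff:
  "us \<in> lists (beta X) \<Longrightarrow> all_ultra X us (\<lambda>xs. \<not> \<phi> xs) \<longleftrightarrow> \<not> all_ultra X us \<phi>"
  by (induction us arbitrary: \<phi>) (auto simp: beta_Collect_not_iff)

lemma all_ultra_conj_iff:
  "us \<in> lists (beta X) \<Longrightarrow>
    all_ultra X us (\<lambda>xs. \<phi> xs \<and> \<psi> xs) \<longleftrightarrow> all_ultra X us \<phi> \<and> all_ultra X us \<psi>"
  by (induction us arbitrary: \<phi> \<psi>) (auto simp: beta_Collect_conj_iff)

lemma all_ultra_True: "us \<in> lists (beta X) \<Longrightarrow> all_ultra X us (\<lambda>xs. True)"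
  by (induction us) (auto simp: beta_space)

text \<open>Quantifying over a principal ultrafilter is evaluation at its point.\<close>

lemma all_ultra_principal_append:
  "xs \<in> lists X \<Longrightarrow>
    all_ultra X (map (principal X) xs @ us) \<phi> \<longleftrightarrow> all_ultra X us (\<lambda>ys. \<phi> (xs @ ys))"
proof (induction xs arbitrary: \<phi>)
  case (Cons x xs)
  then have x: "x \<in> X" and xs: "xs \<in> lists X" by auto
  have "all_ultra X (map (principal X) (x # xs) @ us) \<phi> \<longleftrightarrow>
      all_ultra X (map (principal X) xs @ us) (\<lambda>xs. \<phi> (x # xs))"
    unfolding list.map append_Cons all_ultra.simps by (rule Collect_in_principal_iff[OF x])
  then show ?case unfolding Cons.IH[OF xs] append_Cons .
qed simp

lemma all_ultra_principal:
  "xs \<in> lists X \<Longrightarrow> all_ultra X (map (principal X) xs) \<phi> \<longleftrightarrow> \<phi> xs"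
  using all_ultra_principal_append[of xs X "[]" \<phi>] unfolding append_Nil2 all_ultra.simps .

text \<open>The source of right continuity: once the arguments from \<open>X\<close> are evaluated,
  \<open>u\<close> is the outermost quantifier, so the section is a basic set
  \<open>{u \<in> beta X. A \<in> u}\<close> with \<open>A\<close> independent of
  \<open>u\<close>.\<close>

lemma all_ultra_section_clopen:
  assumes "xs \<in> lists X"
  shows "openin (beta_top X) {u \<in> beta X. all_ultra X (map (principal X) xs @ u # vs) \<phi>} \<and>
    closedin (beta_top X) {u \<in> beta X. all_ultra X (map (principal X) xs @ u # vs) \<phi>}"
  unfolding all_ultra_principal_append[OF assms] all_ultra.simps
  by (rule clopen_beta_basic) blast

lemma nlists_iff_lists: "xs \<in> nlists n X \<longleftrightarrow> xs \<in> lists X \<and> length xs = n"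
  unfolding nlists_def lists_eq_set by blast

lemma map_principal_in_lists: "xs \<in> lists X \<Longrightarrow> map (principal X) xs \<in> lists (beta X)"
  by (induction xs) (simp_all add: principal_in_beta)

lemma map_principal_in_nlists: "xs \<in> nlists n X \<Longrightarrow> map (principal X) xs \<in> nlists n (beta X)"
  by (simp add: nlists_iff_lists map_principal_in_lists)

lemma section_in_nlists:
  assumes "xs \<in> lists X" "vs \<in> lists (beta X)" "length xs + 1 + length vs = n" "u \<in> beta X"
  shows "map (principal X) xs @ u # vs \<in> nlists n (beta X)"
  using assms(2-4) map_principal_in_lists[OF assms(1)] by (simp add: nlists_iff_lists)

section \<open>Operations\<close>

text \<open>The arguments are replaced by principal ultrafilters from left to right, the order in which
  right continuity is available.\<close>

lemma RC_determined:
  assumes g: "g \<in> RC X n" "h \<in> RC X n"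
    and eq: "\<And>xs. xs \<in> nlists n X \<Longrightarrow> g (map (principal X) xs) = h (map (principal X) xs)"
  shows "g = h"
proof -
  have *: "g (map (principal X) xs @ vs) = h (map (principal X) xs @ vs)"
    if "xs \<in> lists X" "vs \<in> lists (beta X)" "length xs + length vs = n" for xs vs
    using that
  proof (induction vs arbitrary: xs)
    case Nil
    then show ?case using eq by (simp add: nlists_iff_lists)
  next
    case (Cons u vs)
    have cont: "continuous_map (beta_top X) (beta_top X) (\<lambda>u. k (map (principal X) xs @ u # vs))"
      if "k \<in> RC X n" for k
      using that Cons.prems unfolding RC_def by simp
    \<comment> \<open>For principal \<open>u\<close> the prefix from \<open>X\<close> grows by one
      entry, which is why the induction keeps \<open>xs\<close> arbitrary.\<close>
    have dense: "g (map (principal X) xs @ principal X x # vs) =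
        h (map (principal X) xs @ principal X x # vs)" if "x \<in> X" for x
      using Cons.IH[of "xs @ [x]"] Cons.prems that by simp
    have "u \<in> beta X" using Cons.prems by simp
    then show ?case
      using continuous_map_beta_dense_eq[OF Hausdorff_beta_top cont[OF g(1)] cont[OF g(2)] dense]
      by simp
  qed
  show ?thesis
  proof (rule extensionalityI)
    show "g \<in> extensional (nlists n (beta X))" "h \<in> extensional (nlists n (beta X))"
      using g unfolding RC_def Ops_def by (auto simp: PiE_def)
    show "g us = h us" if "us \<in> nlists n (beta X)" for us
      using *[of "[]" us] that by (simp add: nlists_iff_lists)
  qed
qed

text \<open>The topology is pulled back from a product of Hausdorff spaces along restriction to
  principal tuples, and \<open>RC_determined\<close> makes this restriction injective.\<close>

lemma Hausdorff_RC_top: "Hausdorff_space (RC_top X n)"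
proof (rule Hausdorff_space_injective_preimage)
  let ?r = "\<lambda>g. \<lambda>xs \<in> nlists n X. g (map (principal X) xs)"
  let ?P = "product_topology (\<lambda>_. beta_top X) (nlists n X)"
  show "Hausdorff_space ?P" by (simp add: Hausdorff_space_product_topology Hausdorff_beta_top)
  show "continuous_map (RC_top X n) ?P ?r"
    using continuous_map_pullback[OF continuous_map_id, of "RC X n" ?r ?P]
    unfolding RC_top_def by (simp add: o_def)
  show "inj_on ?r (topspace (RC_top X n))"
  proof (rule inj_onI)
    fix g h assume "g \<in> topspace (RC_top X n)" "h \<in> topspace (RC_top X n)" and eq: "?r g = ?r h"
    then have "g \<in> RC X n" "h \<in> RC X n" by (auto simp: RC_top_def topspace_pullback_topology)
    then show "g = h"
    proof (rule RC_determined)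
      show "g (map (principal X) xs) = h (map (principal X) xs)" if "xs \<in> nlists n X" for xs
        using fun_cong[OF eq, of xs] that by simp
    qed
  qed
qed

text \<open>The quantifier over operations stands innermost. At a principal tuple it is the only one
  left, and the value is the image of \<open>\<ff>\<close> under evaluation at that tuple.\<close>

definition ultra_op :: "'a set \<Rightarrow> nat \<Rightarrow> ('a list \<Rightarrow> 'a) set set \<Rightarrow> 'a set set list \<Rightarrow> 'a set set" where
  "ultra_op X n \<ff> = (\<lambda>us \<in> nlists n (beta X).
     {A. A \<subseteq> X \<and> all_ultra X us (\<lambda>xs. {f \<in> Ops X n. f xs \<in> A} \<in> \<ff>)})"

text \<open>Both \<open>\<ff>\<close> and the quantifier prefix commute with conjunction and
  negation, so the condition on \<open>A\<close> inherits the ultrafilter laws.\<close>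

lemma ultra_op_in_beta:
  assumes F: "\<ff> \<in> beta (Ops X n)" and us: "us \<in> nlists n (beta X)"
  shows "ultra_op X n \<ff> us \<in> beta X"
proof -
  let ?Q = "\<lambda>A xs. {f \<in> Ops X n. f xs \<in> A} \<in> \<ff>"
  have L: "us \<in> lists (beta X)" "length us = n" using us by (auto simp: nlists_iff_lists)
  \<comment> \<open>The inner sets are rewritten using \<open>f xs \<in> X\<close>, which is
    available only for tuples \<open>xs\<close> from \<open>X\<close>.\<close>
  have cong: "all_ultra X us \<phi> \<longleftrightarrow> all_ultra X us \<psi>"
    if "\<And>xs. xs \<in> nlists n X \<Longrightarrow> \<phi> xs \<longleftrightarrow> \<psi> xs" for \<phi> \<psi>
    using all_ultra_cong[of us X] that L(2) by blast
  have ops: "f xs \<in> X" if "f \<in> Ops X n" "xs \<in> nlists n X" for f xs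
    using that by (auto simp: Ops_def)
  have "{f \<in> Ops X n. f xs \<in> X} = Ops X n" if "xs \<in> nlists n X" for xs
    using ops that by blast
  then have "all_ultra X us (?Q X) \<longleftrightarrow> all_ultra X us (\<lambda>_. True)"
    by (intro cong) (simp add: beta_space[OF F])
  then have space: "all_ultra X us (?Q X)" using all_ultra_True[OF L(1)] by simp
  have inter: "all_ultra X us (?Q (A \<inter> B)) \<longleftrightarrow> all_ultra X us (?Q A) \<and> all_ultra X us (?Q B)" for A B
    by (simp add: all_ultra_conj_iff[OF L(1), symmetric] beta_Collect_conj_iff[OF F, symmetric])
  have diff: "all_ultra X us (?Q (X - A)) \<longleftrightarrow> \<not> all_ultra X us (?Q A)" for A
  proof -
    have "{f \<in> Ops X n. f xs \<in> X - A} = {f \<in> Ops X n. f xs \<notin> A}" if "xs \<in> nlists n X" for xs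
      using ops that by blast
    then have "all_ultra X us (?Q (X - A)) \<longleftrightarrow> all_ultra X us (\<lambda>xs. \<not> ?Q A xs)"
      by (intro cong) (simp add: beta_Collect_not_iff[OF F])
    then show ?thesis using all_ultra_not_iff[OF L(1)] by simp
  qed
  have mem: "A \<in> ultra_op X n \<ff> us \<longleftrightarrow> A \<subseteq> X \<and> all_ultra X us (?Q A)" for A
    using us by (simp add: ultra_op_def)
  show ?thesis
  proof (rule betaI)
    fix A B assume "A \<in> ultra_op X n \<ff> us" "A \<subseteq> B" "B \<subseteq> X"
    \<comment> \<open>Upward closure comes from \<open>inter\<close>, since
      \<open>A \<inter> B = A\<close>.\<close>
    then show "B \<in> ultra_op X n \<ff> us"
      using inter[of A B] by (simp add: mem Int_absorb2)
  qed (use space inter diff in \<open>auto simp: mem\<close>)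
qed

lemma ultra_op_in_RC:
  assumes F: "\<ff> \<in> beta (Ops X n)"
  shows "ultra_op X n \<ff> \<in> RC X n"
  unfolding RC_def
proof (intro CollectI conjI ballI impI)
  show "ultra_op X n \<ff> \<in> Ops (beta X) n"
    using ultra_op_in_beta[OF F] by (auto simp: Ops_def ultra_op_def)
next
  fix xs vs assume xv: "xs \<in> lists X" "vs \<in> lists (beta X)" "length xs + 1 + length vs = n"
  show "continuous_map (beta_top X) (beta_top X) (\<lambda>u. ultra_op X n \<ff> (map (principal X) xs @ u # vs))"
  proof (rule continuous_map_into_beta_top)
    fix A assume "A \<subseteq> X"
    then have "{u \<in> beta X. A \<in> ultra_op X n \<ff> (map (principal X) xs @ u # vs)} =
      {u \<in> beta X. all_ultra X (map (principal X) xs @ u # vs) (\<lambda>xs. {f \<in> Ops X n. f xs \<in> A} \<in> \<ff>)}"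
      using section_in_nlists[OF xv] by (auto simp: ultra_op_def)
    then show "openin (beta_top X) {u \<in> topspace (beta_top X).
        A \<in> ultra_op X n \<ff> (map (principal X) xs @ u # vs)}"
      using all_ultra_section_clopen[OF xv(1)] by simp
  qed (use ultra_op_in_beta[OF F] section_in_nlists[OF xv] in auto)
qed

text \<open>Only principal tuples have to be tested. There the preimage of the basic set of
  \<open>A\<close> is the basic set of \<open>{f \<in> Ops X n. f xs \<in> A}\<close>.\<close>

lemma continuous_ultra_op: "continuous_map (beta_top (Ops X n)) (RC_top X n) (ultra_op X n)"
  unfolding RC_top_def
proof (rule continuous_map_pullback')
  let ?r = "\<lambda>g. \<lambda>xs \<in> nlists n X. g (map (principal X) xs)"
  have "continuous_map (beta_top (Ops X n)) (beta_top X) (\<lambda>\<ff>. ultra_op X n \<ff> (map (principal X) xs))"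
    if xs: "xs \<in> nlists n X" for xs
  proof (rule continuous_map_into_beta_top)
    fix A assume "A \<subseteq> X"
    then have "{\<ff> \<in> beta (Ops X n). A \<in> ultra_op X n \<ff> (map (principal X) xs)} =
        {\<ff> \<in> beta (Ops X n). {f \<in> Ops X n. f xs \<in> A} \<in> \<ff>}"
      using xs map_principal_in_nlists[OF xs]
      by (auto simp: ultra_op_def all_ultra_principal nlists_iff_lists)
    then show "openin (beta_top (Ops X n)) {\<ff> \<in> topspace (beta_top (Ops X n)).
        A \<in> ultra_op X n \<ff> (map (principal X) xs)}"
      using openin_beta_top_basic[of "{f \<in> Ops X n. f xs \<in> A}"] by simp
  qed (use ultra_op_in_beta map_principal_in_nlists[OF xs] in auto)
  then show "continuous_map (beta_top (Ops X n)) (product_topology (\<lambda>_. beta_top X) (nlists n X))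
      (?r \<circ> ultra_op X n)"
    by (auto simp: continuous_map_componentwise o_def)
qed (use ultra_op_in_RC in auto)

lemma ultra_op_principal:
  assumes "f \<in> Ops X n"
  shows "ultra_op X n (principal (Ops X n) f) = op_ext X n f"
  unfolding ultra_op_def op_ext_def Collect_in_principal_iff[OF assms] ..

lemma is_ultra_limit_e_op:
  assumes "\<ff> \<in> beta (Ops X n)"
  shows "is_ultra_limit (RC_top X n) (i_op X n \<ff>) (e_op X n \<ff>)"
  unfolding i_op_def e_op_def
proof (rule ultra_limit_unique_extension[OF Hausdorff_RC_top _ continuous_ultra_op
      ultra_op_principal assms])
  show "topspace (RC_top X n) \<subseteq> Ops (beta X) n"
    by (auto simp: RC_top_def RC_def topspace_pullback_topology)
qed

section \<open>Relations\<close>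

text \<open>As for operations, arguments are made principal from left to right, with
  \<open>clopen_beta_iff_principal\<close> in place of the density argument.\<close>

lemma RClop_determined:
  assumes P: "P \<in> RClop X n" "Q \<in> RClop X n"
    and eq: "\<And>xs. xs \<in> nlists n X \<Longrightarrow> map (principal X) xs \<in> P \<longleftrightarrow> map (principal X) xs \<in> Q"
  shows "P = Q"
proof -
  have *: "map (principal X) xs @ vs \<in> P \<longleftrightarrow> map (principal X) xs @ vs \<in> Q"
    if "xs \<in> lists X" "vs \<in> lists (beta X)" "length xs + length vs = n" for xs vs
    using that
  proof (induction vs arbitrary: xs)
    case Nil
    then show ?case using eq by (simp add: nlists_iff_lists)
  next
    case (Cons u vs)
    \<comment> \<open>This trades the argument \<open>u\<close> for a quantifier over points of
      \<open>X\<close>, to which the induction hypothesis applies with the prefix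
      \<open>xs @ [x]\<close>.\<close>
    have sec: "map (principal X) xs @ u # vs \<in> R \<longleftrightarrow>
        {x \<in> X. map (principal X) xs @ principal X x # vs \<in> R} \<in> u" if R: "R \<in> RClop X n" for R
    proof -
      let ?C = "{u \<in> beta X. map (principal X) xs @ u # vs \<in> R}"
      have u: "u \<in> beta X" using Cons.prems by simp
      have "openin (beta_top X) ?C" "closedin (beta_top X) ?C"
        using R Cons.prems unfolding RClop_def by (auto simp: Let_def)
      then have "u \<in> ?C \<longleftrightarrow> {x \<in> X. principal X x \<in> ?C} \<in> u"
        by (rule clopen_beta_iff_principal) (rule u)
      moreover have "{x \<in> X. principal X x \<in> ?C} =
          {x \<in> X. map (principal X) xs @ principal X x # vs \<in> R}"
        using principal_in_beta by auto
      ultimately show ?thesis using u by simp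
    qed
    have "map (principal X) xs @ principal X x # vs \<in> P \<longleftrightarrow>
        map (principal X) xs @ principal X x # vs \<in> Q" if "x \<in> X" for x
      using Cons.IH[of "xs @ [x]"] Cons.prems that by auto
    then have "{x \<in> X. map (principal X) xs @ principal X x # vs \<in> P} =
        {x \<in> X. map (principal X) xs @ principal X x # vs \<in> Q}" by auto
    then show ?case using sec[OF P(1)] sec[OF P(2)] by simp
  qed
  have "P \<subseteq> nlists n (beta X)" "Q \<subseteq> nlists n (beta X)" using P by (auto simp: RClop_def Rels_def)
  moreover have "us \<in> P \<longleftrightarrow> us \<in> Q" if "us \<in> nlists n (beta X)" for us
    using *[of "[]" us] that by (simp add: nlists_iff_lists)
  ultimately show ?thesis by blast
qed

lemma Hausdorff_RClop_top: "Hausdorff_space (RClop_top X n)"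
proof (rule Hausdorff_space_injective_preimage)
  let ?r = "\<lambda>Q. \<lambda>xs \<in> nlists n X. indicator Q (map (principal X) xs) :: nat"
  let ?P = "product_topology (\<lambda>_. discrete_topology {0, 1::nat}) (nlists n X)"
  show "Hausdorff_space ?P" by (simp add: Hausdorff_space_product_topology)
  show "continuous_map (RClop_top X n) ?P ?r"
    using continuous_map_pullback[OF continuous_map_id, of "RClop X n" ?r ?P]
    unfolding RClop_top_def by (simp add: o_def)
  show "inj_on ?r (topspace (RClop_top X n))"
  proof (rule inj_onI)
    fix P Q assume "P \<in> topspace (RClop_top X n)" "Q \<in> topspace (RClop_top X n)" and eq: "?r P = ?r Q"
    then have "P \<in> RClop X n" "Q \<in> RClop X n" by (auto simp: RClop_top_def topspace_pullback_topology)
    then show "P = Q"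
    proof (rule RClop_determined)
      show "map (principal X) xs \<in> P \<longleftrightarrow> map (principal X) xs \<in> Q" if "xs \<in> nlists n X" for xs
        using fun_cong[OF eq, of xs] that by (simp add: indicator_def of_bool_eq_iff)
    qed
  qed
qed

definition ultra_rel :: "'a set \<Rightarrow> nat \<Rightarrow> 'a list set set set \<Rightarrow> 'a set set list set" where
  "ultra_rel X n \<rr> = {us \<in> nlists n (beta X). all_ultra X us (\<lambda>xs. {Q \<in> Rels X n. xs \<in> Q} \<in> \<rr>)}"

lemma ultra_rel_in_RClop: "ultra_rel X n \<rr> \<in> RClop X n"
  unfolding RClop_def Let_def
proof (intro CollectI conjI ballI impI)
  show "ultra_rel X n \<rr> \<in> Rels (beta X) n" by (auto simp: Rels_def ultra_rel_def)
next
  fix xs vs assume xv: "xs \<in> lists X" "vs \<in> lists (beta X)" "length xs + 1 + length vs = n"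
  have "{u \<in> beta X. map (principal X) xs @ u # vs \<in> ultra_rel X n \<rr>} =
      {u \<in> beta X. all_ultra X (map (principal X) xs @ u # vs) (\<lambda>xs. {Q \<in> Rels X n. xs \<in> Q} \<in> \<rr>)}"
    using section_in_nlists[OF xv] by (auto simp: ultra_rel_def)
  then show "openin (beta_top X) {u \<in> beta X. map (principal X) xs @ u # vs \<in> ultra_rel X n \<rr>}"
    "closedin (beta_top X) {u \<in> beta X. map (principal X) xs @ u # vs \<in> ultra_rel X n \<rr>}"
    using all_ultra_section_clopen[OF xv(1)] by simp_all
qed

lemma continuous_ultra_rel: "continuous_map (beta_top (Rels X n)) (RClop_top X n) (ultra_rel X n)"
  unfolding RClop_top_def
proof (rule continuous_map_pullback')
  let ?r = "\<lambda>Q. \<lambda>xs \<in> nlists n X. indicator Q (map (principal X) xs) :: nat"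
  let ?B = "beta_top (Rels X n)"
  have "continuous_map ?B (discrete_topology {0, 1::nat})
      (\<lambda>\<rr>. indicator (ultra_rel X n \<rr>) (map (principal X) xs))"
    if xs: "xs \<in> nlists n X" for xs
  proof -
    let ?A = "{Q \<in> Rels X n. xs \<in> Q}"
    \<comment> \<open>At a principal tuple all quantifiers but the one over relations are evaluated,
      so the coordinate is the characteristic function of a clopen set.\<close>
    have ind: "indicator (ultra_rel X n \<rr>) (map (principal X) xs) = (if ?A \<in> \<rr> then 1 else 0::nat)" for \<rr>
      using xs map_principal_in_nlists[OF xs]
      by (auto simp: ultra_rel_def all_ultra_principal nlists_iff_lists)
    have clopen: "openin ?B {\<rr> \<in> beta (Rels X n). ?A \<in> \<rr>}" "openin ?B {\<rr> \<in> beta (Rels X n). ?A \<notin> \<rr>}"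
    proof -
      have "{\<rr> \<in> beta (Rels X n). ?A \<notin> \<rr>} = beta (Rels X n) - {\<rr> \<in> beta (Rels X n). ?A \<in> \<rr>}" by auto
      then show "openin ?B {\<rr> \<in> beta (Rels X n). ?A \<in> \<rr>}" "openin ?B {\<rr> \<in> beta (Rels X n). ?A \<notin> \<rr>}"
        using clopen_beta_basic[of ?A "Rels X n"] by (auto simp: closedin_def)
    qed
    \<comment> \<open>The target is discrete, so every \<open>V\<close> needs an open preimage; it
      is a union of at most two clopen pieces.\<close>
    have "openin ?B {\<rr> \<in> beta (Rels X n). (if ?A \<in> \<rr> then 1 else 0::nat) \<in> V}" for V
    proof -
      have "{\<rr> \<in> beta (Rels X n). (if ?A \<in> \<rr> then 1 else 0::nat) \<in> V} =
          (if 1 \<in> V then {\<rr> \<in> beta (Rels X n). ?A \<in> \<rr>} else {}) \<union>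
          (if 0 \<in> V then {\<rr> \<in> beta (Rels X n). ?A \<notin> \<rr>} else {})" by auto
      then show ?thesis using clopen by auto
    qed
    then show ?thesis by (auto simp: continuous_map_def ind)
  qed
  then show "continuous_map ?B (product_topology (\<lambda>_. discrete_topology {0, 1::nat}) (nlists n X))
      (?r \<circ> ultra_rel X n)"
    by (auto simp: continuous_map_componentwise o_def)
qed (use ultra_rel_in_RClop in auto)

lemma ultra_rel_principal:
  assumes "Q \<in> Rels X n"
  shows "ultra_rel X n (principal (Rels X n) Q) = rel_ext X n Q"
  unfolding ultra_rel_def rel_ext_def Collect_in_principal_iff[OF assms] ..

lemma is_ultra_limit_e_rel:
  assumes "\<rr> \<in> beta (Rels X n)"
  shows "is_ultra_limit (RClop_top X n) (i_rel X n \<rr>) (e_rel X n \<rr>)"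
  unfolding i_rel_def e_rel_def
proof (rule ultra_limit_unique_extension[OF Hausdorff_RClop_top _ continuous_ultra_rel
      ultra_rel_principal assms])
  show "topspace (RClop_top X n) \<subseteq> Rels (beta X) n"
    by (auto simp: RClop_top_def RClop_def topspace_pullback_topology)
qed


section \<open>From single symbols to models\<close>

theorem theorem37:
  fixes X :: "'a set" and L :: "('f, 'r) signature"
    and \<AA> :: "('a set set, 'f, ('a list \<Rightarrow> 'a) set set, 'r, 'a list set set set) model"
  assumes "narrow_model L X \<AA>"
  shows "lim_model L X (i_model L X \<AA>) = e_model L X \<AA> \<and>
         (\<forall>F \<in> fsyms L. is_ultra_limit (RC_top X (far L F))
               (i_op X (far L F) (op_interp \<AA> F)) (e_op X (far L F) (op_interp \<AA> F))) \<and>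
         (\<forall>R \<in> psyms L. is_ultra_limit (RClop_top X (par L R))
               (i_rel X (par L R) (rel_interp \<AA> R)) (e_rel X (par L R) (rel_interp \<AA> R)))"
proof -
  have ops: "is_ultra_limit (RC_top X (far L F))
      (i_op X (far L F) (op_interp \<AA> F)) (e_op X (far L F) (op_interp \<AA> F))" if "F \<in> fsyms L" for F
    using assms that by (intro is_ultra_limit_e_op) (auto simp: narrow_model_def)
  have rels: "is_ultra_limit (RClop_top X (par L R))
      (i_rel X (par L R) (rel_interp \<AA> R)) (e_rel X (par L R) (rel_interp \<AA> R))" if "R \<in> psyms L" for R
    using assms that by (intro is_ultra_limit_e_rel) (auto simp: narrow_model_def)
  have "lim_model L X (i_model L X \<AA>) = e_model L X \<AA>"
    unfolding lim_model_def i_model_def e_model_def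
    \<comment> \<open>The limits are known only at symbols of \<open>L\<close>;
      \<open>restrict_cong\<close> supplies this membership under the restricted
      interpretations.\<close>
    by (simp add: ultra_lim_eq[OF ops] ultra_lim_eq[OF rels] cong: restrict_cong)
  then show ?thesis using ops rels by blast
qed

end
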